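(* Let $A,N_1,\dots,N_m\in\mathbb{R}^{n\times n}$ be symmetric with $A\prec0$, let $B\in\mathbb{R}^{n\times r}$, and assume $\rho(\mathscr{L}^{-1}\Pi)<1$. Consider the sequence $$\hat X_0=0,\qquad \hat X_{k+1}=\hat X_k-\mathscr{L}^{-1}(\mathcal{R}_k),\quad k=0,1,\dots,$$ where $\mathcal{R}_k:=\mathscr{L}(\hat X_k)+\Pi(\hat X_k)+BB^T$ is the residual associated with $\hat X_k$. Then $\hat X_k=\hat X_k^T\succeq0$ and $\mathcal{R}_k=\mathcal{R}_k^T\succeq0$ for all $k\ge0$. Furthermore, this iteration is equivalent to the fixed-point iteration $$\mathscr{L}(\hat X_{k+1})=-\Pi(\hat X_k)-BB^T,\quad k=0,1,\dots,\qquad \hat X_0=0,$$ i.e. both iterations generate the same sequence.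
   Context: For $X\in\mathbb{R}^{n\times n}$: $\mathscr{L}(X):=AX+XA^T$ and $\Pi(X):=\sum_{i=1}^m N_iXN_i^T$. $\rho$ denotes the spectral radius of a linear operator on $\mathbb{R}^{n\times n}$. The orderings $\prec,\succeq$ are the Loewner ordering on symmetric matrices. *)

theory Defs
  imports "HOL-Analysis.Analysis"
begin

definition symmetric :: "real ^ 'n ^ 'n \<Rightarrow> bool" where
  "symmetric X \<longleftrightarrow> transpose X = X"

(* Loewner order.  Symmetry of both sides is part of the relation, since over the reals
   the sign of a quadratic form says nothing about the skew-symmetric part. *)
definition loewner_le :: "real ^ 'n ^ 'n \<Rightarrow> real ^ 'n ^ 'n \<Rightarrow> bool"  (infix \<open>\<preceq>\<^sub>L\<close> 50) where
  "X \<preceq>\<^sub>L Y \<longleftrightarrow> symmetric X \<and> symmetric Y \<and> (\<forall>v. 0 \<le> v \<bullet> ((Y - X) *v v))"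

definition loewner_less :: "real ^ 'n ^ 'n \<Rightarrow> real ^ 'n ^ 'n \<Rightarrow> bool"  (infix \<open>\<prec>\<^sub>L\<close> 50) where
  "X \<prec>\<^sub>L Y \<longleftrightarrow> symmetric X \<and> symmetric Y \<and> (\<forall>v. v \<noteq> 0 \<longrightarrow> 0 < v \<bullet> ((Y - X) *v v))"

definition lyap :: "real ^ 'n ^ 'n \<Rightarrow> real ^ 'n ^ 'n \<Rightarrow> real ^ 'n ^ 'n" where
  "lyap A X = A ** X + X ** transpose A"

definition Pi_op :: "nat \<Rightarrow> (nat \<Rightarrow> real ^ 'n ^ 'n) \<Rightarrow> real ^ 'n ^ 'n \<Rightarrow> real ^ 'n ^ 'n" where
  "Pi_op m N X = (\<Sum>i = 1..m. N i ** X ** transpose (N i))"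

definition residual ::
  "real ^ 'n ^ 'n \<Rightarrow> nat \<Rightarrow> (nat \<Rightarrow> real ^ 'n ^ 'n) \<Rightarrow> real ^ 'r ^ 'n \<Rightarrow> real ^ 'n ^ 'n \<Rightarrow> real ^ 'n ^ 'n" where
  "residual A m N B X = lyap A X + Pi_op m N X + B ** transpose B"

(* The complexification of a real vector space V is V \<times> V, with (x, y) standing for x + i y. *)
definition cplx_op :: "('a \<Rightarrow> 'a) \<Rightarrow> 'a \<times> 'a \<Rightarrow> 'a \<times> 'a" where
  "cplx_op T z = (T (fst z), T (snd z))"

definition cplx_scale :: "complex \<Rightarrow> 'a::real_vector \<times> 'a \<Rightarrow> 'a \<times> 'a" where
  "cplx_scale c z =
     (Re c *\<^sub>R fst z - Im c *\<^sub>R snd z, Im c *\<^sub>R fst z + Re c *\<^sub>R snd z)"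

definition op_spectrum :: "('a::real_vector \<Rightarrow> 'a) \<Rightarrow> complex set" where
  "op_spectrum T = {c. \<exists>z. z \<noteq> 0 \<and> cplx_op T z = cplx_scale c z}"

(* Intended for linear T on a space of finite positive dimension: the spectrum is then
   finite and nonempty, and the supremum is a maximum. *)
definition op_spectral_radius :: "('a::real_vector \<Rightarrow> 'a) \<Rightarrow> real" where
  "op_spectral_radius T = Sup (cmod ` op_spectrum T)"

end

theory Submission
  imports Defs
begin

text \<open>Since \<open>A\<close> is negative definite, \<open>\<L>(X) = A X + X A\<close> is bijective, because
  \<open>\<langle>X, \<L>(X)\<rangle> < 0\<close> in the Frobenius inner product for \<open>X \<noteq> 0\<close>. Moreover \<open>- \<L>\<^sup>-\<^sup>1\<close> preserves
  positive semidefiniteness: at an eigenvector \<open>v\<close> of \<open>X\<close> for the smallest eigenvalue \<open>\<lambda>\<close> one has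
  \<open>v \<bullet> \<L>(X) v = 2 \<lambda> (v \<bullet> A v)\<close>, so \<open>\<L>(X) \<preceq> 0\<close> forces \<open>\<lambda> \<ge> 0\<close>. The update collapses
  to \<open>\<L>(X\<^sub>k\<^sub>+\<^sub>1) = - \<Pi>(X\<^sub>k) - B B\<^sup>T\<close>, which makes the iterates positive semidefinite, and the
  residuals then satisfy \<open>R\<^sub>k\<^sub>+\<^sub>1 = \<Pi>(- \<L>\<^sup>-\<^sup>1(R\<^sub>k))\<close> with \<open>R\<^sub>0 = B B\<^sup>T\<close>.\<close>

section \<open>Transposes, linearity and Frobenius products\<close>

lemma transpose_add: "transpose (X + Y) = transpose X + transpose (Y :: real ^ 'n ^ 'm)"
  by (simp add: transpose_def vec_eq_iff)

lemma transpose_minus: "transpose (- X) = - transpose (X :: real ^ 'n ^ 'm)"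
  by (simp add: transpose_def vec_eq_iff)

lemma matrix_vector_mult_minus_left: "(- X) *v v = - (X *v (v :: real ^ 'n))"
  using matrix_vector_mult_diff_rdistrib[of 0 X v] by simp

lemma linear_matrix_mult_left: "linear (\<lambda>X :: real ^ 'p ^ 'n. (M :: real ^ 'n ^ 'm) ** X)"
  by (rule linearI)
    (simp_all add: matrix_matrix_mult_def vec_eq_iff sum.distrib sum_distrib_left algebra_simps)

lemma linear_matrix_mult_right: "linear (\<lambda>X :: real ^ 'n ^ 'm. X ** (M :: real ^ 'p ^ 'n))"
  by (rule linearI)
    (simp_all add: matrix_matrix_mult_def vec_eq_iff sum.distrib sum_distrib_left algebra_simps)

lemma inner_transpose: "transpose X \<bullet> transpose Y = X \<bullet> (Y :: real ^ 'n ^ 'm)"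
  unfolding inner_vec_def transpose_def by (simp add: sum.swap[of _ "UNIV :: 'n set"])

lemma inner_congruence:
  fixes M :: "real ^ 'n ^ 'm" and X :: "real ^ 'n ^ 'n"
  shows "v \<bullet> ((M ** X ** transpose M) *v v)
    = (transpose M *v v) \<bullet> (X *v (transpose M *v v))"
  by (simp add: dot_lmul_matrix flip: matrix_vector_mul_assoc)

section \<open>The cone of positive semidefinite matrices\<close>

lemma loewner_nonneg_iff: "0 \<preceq>\<^sub>L (X :: real ^ 'n ^ 'n) \<longleftrightarrow> symmetric X \<and> (\<forall>v. 0 \<le> v \<bullet> (X *v v))"
proof -
  have "symmetric (0 :: real ^ 'n ^ 'n)"
    by (simp add: symmetric_def transpose_def vec_eq_iff)
  then show ?thesis
    by (simp add: loewner_le_def)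
qed

lemma loewner_nonneg_zero: "0 \<preceq>\<^sub>L 0"
  by (simp add: loewner_nonneg_iff symmetric_def transpose_def vec_eq_iff)

lemma loewner_nonneg_add: "0 \<preceq>\<^sub>L X \<Longrightarrow> 0 \<preceq>\<^sub>L Y \<Longrightarrow> 0 \<preceq>\<^sub>L X + Y"
  by (simp add: loewner_nonneg_iff symmetric_def transpose_add
      matrix_vector_mult_add_rdistrib inner_add_right)

lemma loewner_nonneg_sum: "(\<And>i. i \<in> I \<Longrightarrow> 0 \<preceq>\<^sub>L F i) \<Longrightarrow> 0 \<preceq>\<^sub>L (\<Sum>i\<in>I. F i)"
  by (induction I rule: infinite_finite_induct)
    (auto simp: loewner_nonneg_zero intro: loewner_nonneg_add)

lemma loewner_nonneg_congruence:
  assumes "0 \<preceq>\<^sub>L X"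
  shows "0 \<preceq>\<^sub>L M ** X ** transpose M"
  using assms
  by (simp add: loewner_nonneg_iff symmetric_def matrix_transpose_mul
      inner_congruence matrix_mul_assoc)

lemma loewner_nonneg_gram: "0 \<preceq>\<^sub>L B ** transpose B"
proof -
  have "0 \<le> v \<bullet> ((B ** transpose B) *v v)" for v
    using inner_ge_zero[of "v v* B"]
    by (simp add: dot_lmul_matrix flip: matrix_vector_mul_assoc)
  then show ?thesis
    by (simp add: loewner_nonneg_iff symmetric_def matrix_transpose_mul)
qed

lemma loewner_nonneg_Pi_op: "0 \<preceq>\<^sub>L X \<Longrightarrow> 0 \<preceq>\<^sub>L Pi_op m N X"
  unfolding Pi_op_def by (intro loewner_nonneg_sum loewner_nonneg_congruence)

lemma Pi_op_diff: "Pi_op m N (X - Y) = Pi_op m N X - Pi_op m N Y"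
  by (simp add: Pi_op_def linear_diff[OF linear_matrix_mult_left]
      linear_diff[OF linear_matrix_mult_right] sum_subtractf)

section \<open>Bijectivity of the Lyapunov operator\<close>

lemma inner_of_loewner_neg:
  assumes "A \<prec>\<^sub>L 0"
  shows "v \<bullet> (A *v v) \<le> 0" and "0 \<le> v \<bullet> (A *v v) \<Longrightarrow> v = 0"
proof -
  have neg: "w \<noteq> 0 \<Longrightarrow> w \<bullet> (A *v w) < 0" for w
    using assms by (auto simp: loewner_less_def matrix_vector_mult_minus_left)
  show "v \<bullet> (A *v v) \<le> 0"
    using neg[of v] by (cases "v = 0") auto
  show "0 \<le> v \<bullet> (A *v v) \<Longrightarrow> v = 0"
    using neg[of v] by force
qed

lemma linear_lyap: "linear (lyap A)"
  unfolding lyap_def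
  by (intro linear_compose_add linear_matrix_mult_left linear_matrix_mult_right)

lemma transpose_lyap: "transpose (lyap A X) = lyap A (transpose X)"
  by (simp add: lyap_def transpose_add matrix_transpose_mul add.commute)

text \<open>Row i of \<open>X ** transpose A\<close> is \<open>A\<close> applied to row i of
  \<open>X\<close>, so the Frobenius product splits into values of the quadratic form of
  \<open>A\<close>, whose sign is known.\<close>

lemma inner_matrix_mult_right:
  fixes X :: "real ^ 'n ^ 'm"
  shows "X \<bullet> (X ** transpose A) = (\<Sum>i\<in>UNIV. X $ i \<bullet> (A *v X $ i))"
  by (simp add: inner_vec_def matrix_matrix_mult_def matrix_vector_mult_def transpose_def
      mult.commute)

lemma inj_lyap:
  fixes A :: "real ^ 'n ^ 'n"
  assumes "A \<prec>\<^sub>L 0"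
  shows "inj (lyap A)"
proof -
  have "X = 0" if "lyap A X = 0" for X
  proof -
    note neg = inner_of_loewner_neg[OF assms]
    define g where "g Z = (\<Sum>i\<in>UNIV. Z $ i \<bullet> (A *v Z $ i))" for Z :: "real ^ 'n ^ 'n"
    have g: "g Z \<le> 0" for Z
      unfolding g_def by (intro sum_nonpos neg(1))
    \<comment> \<open>\<open>A ** X\<close> is the transpose of
      \<open>transpose X ** transpose A\<close>, so this half sums the form of \<open>A\<close> over
      the columns of \<open>X\<close>. Both halves are nonpositive; as they add up to 0, each
      vanishes.\<close>
    have "X \<bullet> (A ** X) = g (transpose X)"
      by (simp add: g_def matrix_transpose_mul inner_transpose[of X, symmetric]
          flip: inner_matrix_mult_right)
    moreover have "X \<bullet> (X ** transpose A) = g X"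
      by (simp add: g_def inner_matrix_mult_right)
    moreover have "X \<bullet> (A ** X) + X \<bullet> (X ** transpose A) = 0"
      using that by (simp add: lyap_def flip: inner_add_right)
    ultimately have "g X = 0"
      using g[of X] g[of "transpose X"] by linarith
    then have "\<forall>i. X $ i \<bullet> (A *v X $ i) = 0"
      using sum_nonneg_eq_0_iff[of UNIV "\<lambda>i. - (X $ i \<bullet> (A *v X $ i))"] neg(1)
      by (simp add: g_def sum_negf)
    then have "\<forall>i. X $ i = 0"
      using neg(2) by (metis order_refl)
    then show "X = 0"
      by (simp add: vec_eq_iff)
  qed
  then show ?thesis
    using linear_injective_0[OF linear_lyap] by blast
qed

lemma bij_lyap: "A \<prec>\<^sub>L 0 \<Longrightarrow> bij (lyap A)"
  by (simp add: bij_def inj_lyap linear_lyap linear_injective_imp_surjective)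

section \<open>Smallest eigenvalues and positivity of the negative inverse Lyapunov operator\<close>

text \<open>If \<open>v \<bullet> M v = 0\<close>, then \<open>v\<close> minimises the form \<open>w \<bullet> M w\<close>, so the first-order term in the
  direction \<open>M v\<close> vanishes.\<close>

lemma loewner_nonneg_kernel:
  fixes M :: "real ^ 'n ^ 'n"
  assumes "0 \<preceq>\<^sub>L M" and v: "v \<bullet> (M *v v) = 0"
  shows "M *v v = 0"
proof (rule ccontr)
  assume "M *v v \<noteq> 0"
  define w where "w = M *v v"
  define c where "c = w \<bullet> (M *v w)"
  \<comment> \<open>For c > 0 the form at \<open>v - t *\<^sub>R w\<close> is minimal at t = (w
    \<bullet> w) / c; the added 1 avoids division by zero when c = 0 and still leaves t * c < w
    \<bullet> w.\<close>
  define t where "t = (w \<bullet> w) / (c + 1)"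
  have pos: "0 \<le> u \<bullet> (M *v u)" and sym: "transpose M = M" for u
    using assms(1) by (auto simp: loewner_nonneg_iff symmetric_def)
  have "v \<bullet> (M *v w) = w \<bullet> w"
    by (metis w_def dot_lmul_matrix sym transpose_matrix_vector)
  then have "(v - t *\<^sub>R w) \<bullet> (M *v (v - t *\<^sub>R w)) = t * (t * c - 2 * (w \<bullet> w))"
    using v by (simp add: matrix_vector_mult_diff_distrib matrix_vector_mult_scaleR
        inner_diff_left inner_diff_right c_def algebra_simps flip: w_def)
  then have "0 \<le> t * (t * c - 2 * (w \<bullet> w))"
    using pos by metis
  moreover have w: "0 < w \<bullet> w" and c: "0 \<le> c"
    using \<open>M *v v \<noteq> 0\<close> pos by (simp_all add: w_def c_def)
  then have t: "0 < t"
    unfolding t_def by (intro divide_pos_pos) linarith+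
  moreover have "t * (c + 1) = w \<bullet> w"
    using c by (simp add: t_def)
  then have "t * c - 2 * (w \<bullet> w) < 0"
    using t w unfolding distrib_left by linarith
  ultimately show False
    by (metis mult_pos_neg not_less)
qed

text \<open>The form attains its minimum \<open>l\<close> on the compact unit sphere, and scaling
  extends the bound to all vectors. Hence \<open>X - l *\<^sub>R mat 1\<close> is positive
  semidefinite and its form vanishes at the minimiser, which therefore lies in its kernel.\<close>

lemma smallest_eigenvector:
  fixes X :: "real ^ 'n ^ 'n"
  assumes "symmetric X"
  obtains v l where "norm v = 1" "X *v v = l *\<^sub>R v" "\<And>w. l * (w \<bullet> w) \<le> w \<bullet> (X *v w)"
proof -
  have "continuous_on (sphere 0 1) (\<lambda>v. v \<bullet> (X *v v))"
    by (intro continuous_intros linear_continuous_on_compose matrix_vector_mul_linear)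
  moreover have "sphere 0 1 \<noteq> ({} :: (real ^ 'n) set)"
    by simp
  ultimately obtain v :: "real ^ 'n"
    where v: "norm v = 1" and min: "\<And>w. norm w = 1 \<Longrightarrow> v \<bullet> (X *v v) \<le> w \<bullet> (X *v w)"
    using continuous_attains_inf[of "sphere 0 1" "\<lambda>v. v \<bullet> (X *v v)"] by auto
  define l where "l = v \<bullet> (X *v v)"
  have l: "l * (w \<bullet> w) \<le> w \<bullet> (X *v w)" for w
  proof (cases "w = 0")
    case False
    with min[of "w /\<^sub>R norm w"] have "l \<le> (w \<bullet> (X *v w)) / (norm w)\<^sup>2"
      by (simp add: l_def matrix_vector_mult_scaleR power2_eq_square field_simps)
    with False show ?thesis
      by (simp add: pos_le_divide_eq power2_norm_eq_inner)
  qed simp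
  define M where "M = X - l *\<^sub>R mat 1"
  have M: "M *v w = X *v w - l *\<^sub>R w" for w
    by (simp add: M_def matrix_vector_mult_diff_rdistrib flip: scaleR_matrix_vector_assoc)
  have "symmetric M"
    using assms by (auto simp: M_def symmetric_def transpose_def vec_eq_iff mat_def)
  then have "0 \<preceq>\<^sub>L M"
    using l by (simp add: loewner_nonneg_iff M inner_diff_right)
  moreover have "v \<bullet> (M *v v) = 0"
    using v by (simp add: M inner_diff_right l_def dot_square_norm)
  ultimately have "X *v v = l *\<^sub>R v"
    using loewner_nonneg_kernel[of M v] by (simp add: M)
  with v l show ?thesis
    using that by blast
qed

lemma loewner_nonneg_of_lyap:
  assumes A: "A \<prec>\<^sub>L 0" and Q: "0 \<preceq>\<^sub>L - lyap A X"
  shows "0 \<preceq>\<^sub>L X"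
proof -
  \<comment> \<open>Symmetry of \<open>X\<close> is not assumed: \<open>X\<close> and its transpose
    solve the same Lyapunov equation, so injectivity identifies them.\<close>
  have "lyap A (transpose X) = lyap A X"
    using Q by (simp add: loewner_nonneg_iff symmetric_def transpose_minus transpose_lyap)
  then have X: "transpose X = X"
    using inj_lyap[OF A] by (simp add: inj_eq)
  then have "symmetric X"
    by (simp add: symmetric_def)
  then obtain v l where v: "norm v = 1" "X *v v = l *\<^sub>R v"
    and l: "\<And>w. l * (w \<bullet> w) \<le> w \<bullet> (X *v w)"
    using smallest_eigenvector by blast
  have A_sym: "transpose A = A"
    using A by (simp add: loewner_less_def symmetric_def)
  have "v \<bullet> (X *v (A *v v)) = (X *v v) \<bullet> (A *v v)"
    by (metis X dot_lmul_matrix transpose_matrix_vector)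
  then have "v \<bullet> (lyap A X *v v) = 2 * l * (v \<bullet> (A *v v))"
    by (simp add: lyap_def A_sym matrix_vector_mult_add_rdistrib inner_add_right v
        matrix_vector_mult_scaleR flip: matrix_vector_mul_assoc)
  then have "l * (v \<bullet> (A *v v)) \<le> 0"
    using Q by (auto simp: loewner_nonneg_iff matrix_vector_mult_minus_left
        dest!: spec[of _ v])
  moreover have "v \<bullet> (A *v v) < 0"
    using inner_of_loewner_neg[OF A, of v] v(1) by force
  ultimately have "0 \<le> l"
    by (simp add: mult_le_0_iff)
  then have "0 \<le> w \<bullet> (X *v w)" for w
    using l[of w] by (meson inner_ge_zero mult_nonneg_nonneg order_trans)
  then show ?thesis
    using \<open>symmetric X\<close> by (simp add: loewner_nonneg_iff)
qed

theorem theorem4p1: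
  fixes A :: "real ^ 'n ^ 'n"
    and m :: nat
    and N :: "nat \<Rightarrow> real ^ 'n ^ 'n"
    and B :: "real ^ 'r ^ 'n"
    and X :: "nat \<Rightarrow> real ^ 'n ^ 'n"
  assumes "symmetric A"
    and "\<And>i. i \<in> {1..m} \<Longrightarrow> symmetric (N i)"
    and "A \<prec>\<^sub>L 0"
    and "op_spectral_radius (inv (lyap A) \<circ> Pi_op m N) < 1"
    and "X 0 = 0"
    and "\<And>k. X (Suc k) = X k - inv (lyap A) (residual A m N B (X k))"
  shows "(\<forall>k. X k = transpose (X k) \<and> 0 \<preceq>\<^sub>L X k
            \<and> residual A m N B (X k) = transpose (residual A m N B (X k))
            \<and> 0 \<preceq>\<^sub>L residual A m N B (X k))
    \<and> (\<forall>Y. (Y 0 = 0 \<and> (\<forall>k. lyap A (Y (Suc k)) = - Pi_op m N (Y k) - B ** transpose B))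
            \<longleftrightarrow> Y = X)"
proof -
  let ?L = "lyap A" and ?P = "Pi_op m N" and ?R = "\<lambda>k. residual A m N B (X k)"
  note A = \<open>A \<prec>\<^sub>L 0\<close>
  have L_inv: "?L (inv ?L Z) = Z" for Z
    using bij_lyap[OF A] by (simp add: bij_is_surj surj_f_inv_f)
  \<comment> \<open>Applying \<open>?L\<close> to the update cancels \<open>?L (X k)\<close> against
    the same term of the residual.\<close>
  have step: "?L (X (Suc k)) = - ?P (X k) - B ** transpose B" for k
    by (simp add: assms(6) linear_diff[OF linear_lyap] L_inv residual_def)
  have X_psd: "0 \<preceq>\<^sub>L X k" for k
  proof (induction k)
    case 0
    show ?case
      by (simp add: assms(5) loewner_nonneg_zero)
  next
    case (Suc k)
    then have "0 \<preceq>\<^sub>L ?P (X k) + B ** transpose B"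
      by (intro loewner_nonneg_add loewner_nonneg_Pi_op loewner_nonneg_gram)
    then have "0 \<preceq>\<^sub>L - ?L (X (Suc k))"
      by (simp add: step add.commute)
    then show ?case
      by (rule loewner_nonneg_of_lyap[OF A])
  qed
  have R_psd: "0 \<preceq>\<^sub>L ?R k" for k
  proof (induction k)
    case 0
    have "?R 0 = B ** transpose B"
      by (simp add: assms(5) residual_def Pi_op_def linear_0[OF linear_lyap])
    then show ?case
      by (simp add: loewner_nonneg_gram)
  next
    case (Suc k)
    \<comment> \<open>With the induction hypothesis, this makes the iterates increase in the Loewner
      order.\<close>
    have "- ?L (X (Suc k) - X k) = ?R k"
      by (simp add: linear_diff[OF linear_lyap] step residual_def)
    with Suc have "0 \<preceq>\<^sub>L X (Suc k) - X k"
      by (metis loewner_nonneg_of_lyap[OF A])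
    then have "0 \<preceq>\<^sub>L ?P (X (Suc k) - X k)"
      by (rule loewner_nonneg_Pi_op)
    \<comment> \<open>By \<open>step\<close>, \<open>?L (X (Suc k))\<close> cancels
      \<open>B ** transpose B\<close> in the new residual and leaves the difference of two values of
      \<open>?P\<close>.\<close>
    also have "?P (X (Suc k) - X k) = ?R (Suc k)"
      by (simp add: Pi_op_diff step residual_def)
    finally show ?case .
  qed
  \<comment> \<open>Injectivity of \<open>?L\<close> makes each term determine the next; the other
    direction of the equivalence is \<open>step\<close> itself.\<close>
  have "Y = X" if "Y 0 = 0" "\<forall>k. ?L (Y (Suc k)) = - ?P (Y k) - B ** transpose B" for Y
  proof
    fix k
    show "Y k = X k"
    proof (induction k)
      case 0
      show ?case
        by (simp add: that(1) assms(5))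
    next
      case (Suc k)
      then have "?L (Y (Suc k)) = ?L (X (Suc k))"
        by (simp add: that(2) step)
      then show ?case
        using inj_lyap[OF A] by (simp add: inj_eq)
    qed
  qed
  moreover have "transpose Z = Z" if "0 \<preceq>\<^sub>L Z" for Z :: "real ^ 'n ^ 'n"
    using that by (simp add: loewner_nonneg_iff symmetric_def)
  ultimately show ?thesis
    using X_psd R_psd step assms(5) by metis
qed

end
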